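(* A finitely generated multiplicative system $(X,\mu,S)$ is pretentiously ergodic if and only if $\mathcal{H}_1$ consists of ($\mu$-almost everywhere) constant functions.
   Context: $\mathbb{N}=\{1,2,\dots\}$ and $\mathbb{P}$ is the set of primes. Every probability space $(X,\mu)$ is assumed regular: $X$ is a compact metric space with its Borel $\sigma$-algebra. A multiplicative system $(X,\mu,S)$ consists of a probability space $(X,\mu)$ and a sequence $S=(S_n)_{n\in\mathbb{N}}$ of commuting invertible measure-preserving transformations of $(X,\mu)$ with $S_{nm}=S_n\circ S_m$ for all $n,m\in\mathbb{N}$. It is finitely generated if $\{S_p:p\in\mathbb{P}\}$ is finite. For $F\in L^2(X)$, $S_nF=F\circ S_n$. $\mathcal{H}_1=\{F\in L^2(X):\frac12\sum_{p\in\mathbb{P}}\frac{\|S_pF-F\|_2^2}{p}<\infty\}$. The system is pretentiously ergodic if every measurable $A\subseteq X$ with $\mathbf{1}_A\in\mathcal{H}_1$ satisfies $\mu(A)\in\{0,1\}$. *)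

theory Defs
  imports "HOL-Probability.Probability" "HOL-Computational_Algebra.Primes"
begin

locale regular_prob_space = prob_space M for M :: "'a::metric_space measure" +
  assumes compact_space: "compact (space M)"
    and sets_borel: "sets M = sets (restrict_space borel (space M))"

definition invertible_measure_preserving :: "'a measure \<Rightarrow> ('a \<Rightarrow> 'a) \<Rightarrow> bool" where
  "invertible_measure_preserving M T \<longleftrightarrow>
     T \<in> M \<rightarrow>\<^sub>M M \<and> distr M M T = M \<and>
     bij_betw T (space M) (space M) \<and> inv_into (space M) T \<in> M \<rightarrow>\<^sub>M M"

text \<open>Indices range over the positive integers; the value \<open>S 0\<close> and the values of the maps
  outside \<open>space M\<close> are irrelevant.\<close>

locale multiplicative_system = regular_prob_space M for M :: "'a::metric_space measure" +
  fixes S :: "nat \<Rightarrow> 'a \<Rightarrow> 'a"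
  assumes inv_mp: "n \<ge> 1 \<Longrightarrow> invertible_measure_preserving M (S n)"
    and commute: "\<lbrakk>n \<ge> 1; m \<ge> 1; x \<in> space M\<rbrakk> \<Longrightarrow> S n (S m x) = S m (S n x)"
    and mult: "\<lbrakk>n \<ge> 1; m \<ge> 1; x \<in> space M\<rbrakk> \<Longrightarrow> S (n * m) x = S n (S m x)"

definition finitely_generated :: "'a measure \<Rightarrow> (nat \<Rightarrow> 'a \<Rightarrow> 'a) \<Rightarrow> bool" where
  "finitely_generated M S \<longleftrightarrow> finite {restrict (S p) (space M) |p. prime p}"

text \<open>Elements of \<open>L2 M\<close> are functions rather than classes modulo equality almost everywhere.\<close>

definition L2 :: "'a measure \<Rightarrow> ('a \<Rightarrow> complex) set" where
  "L2 M = {F. F \<in> borel_measurable M \<and> integrable M (\<lambda>x. (cmod (F x))\<^sup>2)}"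

definition norm2 :: "'a measure \<Rightarrow> ('a \<Rightarrow> complex) \<Rightarrow> real" where
  "norm2 M F = sqrt (\<integral>x. (cmod (F x))\<^sup>2 \<partial>M)"

definition H1 :: "'a measure \<Rightarrow> (nat \<Rightarrow> 'a \<Rightarrow> 'a) \<Rightarrow> ('a \<Rightarrow> complex) set" where
  "H1 M S = {F \<in> L2 M.
     (\<lambda>p. 1 / 2 * ((norm2 M (\<lambda>x. (F \<circ> S p) x - F x))\<^sup>2 / real p)) summable_on {p. prime p}}"

definition pretentiously_ergodic :: "'a measure \<Rightarrow> (nat \<Rightarrow> 'a \<Rightarrow> 'a) \<Rightarrow> bool" where
  "pretentiously_ergodic M S \<longleftrightarrow>
     (\<forall>A \<in> sets M. indicator A \<in> H1 M S \<longrightarrow> measure M A \<in> {0, 1})"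

end

theory Submission
  imports Defs
begin

text \<open>Fix \<open>F\<close> in \<open>H1\<close>. By finite generation, the norms of the differences \<open>F \<circ> S p - F\<close> take
  finitely many values, so the nonzero ones are bounded away from \<open>0\<close>. Hence for every event \<open>A\<close> of
  the form \<open>F x \<in> B\<close> the summand of the indicator of \<open>A\<close> at \<open>p\<close> is at most a constant multiple of the
  summand of \<open>F\<close>: it is bounded by \<open>1 / p\<close>, and it vanishes when \<open>F \<circ> S p = F\<close> almost everywhere.
  So the indicator of \<open>A\<close> lies in \<open>H1\<close>, and pretentious ergodicity gives \<open>A\<close> measure \<open>0\<close> or \<open>1\<close>.
  Apply this to the events that the real or imaginary part of \<open>F\<close> lies above or below its mean.\<close>

lemma invertible_measure_preservingD:
  assumes "invertible_measure_preserving M T"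
  shows "T \<in> M \<rightarrow>\<^sub>M M" and "distr M M T = M"
  using assms by (auto simp: invertible_measure_preserving_def)

text \<open>The integral sees \<open>S p\<close> only on \<open>space M\<close>, so the norm factors
  through the restriction of \<open>S p\<close>, and there are finitely many of these.\<close>

lemma finite_norm2_diffs:
  assumes "finitely_generated M S"
  shows "finite ((\<lambda>p. norm2 M (\<lambda>x. (F \<circ> S p) x - F x)) ` {p. prime p})"
proof -
  have "norm2 M (\<lambda>x. (F \<circ> S p) x - F x) =
      norm2 M (\<lambda>x. (F \<circ> restrict (S p) (space M)) x - F x)" for p
    unfolding norm2_def by (intro arg_cong[where f = sqrt] Bochner_Integration.integral_cong) auto
  then have "(\<lambda>p. norm2 M (\<lambda>x. (F \<circ> S p) x - F x)) ` {p. prime p} =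
      (\<lambda>T. norm2 M (\<lambda>x. (F \<circ> T) x - F x)) ` {restrict (S p) (space M) |p. prime p}"
    by (simp only: setcompr_eq_image image_image)
  with assms show ?thesis
    by (simp add: finitely_generated_def)
qed

text \<open>Invariance of the measure carries square integrability from \<open>F\<close> to
  \<open>F \<circ> T\<close>. Integrability has to be known because the Bochner integral of a
  non-integrable function is 0 by default, so without it a vanishing \<open>norm2\<close> would give
  no information.\<close>

lemma L2_comp_diff_integrable:
  assumes "F \<in> L2 M" and T: "invertible_measure_preserving M T"
  shows "integrable M (\<lambda>x. (cmod ((F \<circ> T) x - F x))\<^sup>2)"
proof (rule Bochner_Integration.integrable_bound)
  note [measurable] = invertible_measure_preservingD(1)[OF T]
  have [measurable]: "F \<in> borel_measurable M" and F: "integrable M (\<lambda>x. (cmod (F x))\<^sup>2)"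
    using assms(1) by (auto simp: L2_def)
  have "integrable (distr M M T) (\<lambda>x. (cmod (F x))\<^sup>2)"
    using F by (simp add: invertible_measure_preservingD(2)[OF T])
  then have "integrable M (\<lambda>x. (cmod (F (T x)))\<^sup>2)"
    by (subst (asm) integrable_distr_eq) auto
  with F show "integrable M (\<lambda>x. 2 * (cmod (F (T x)))\<^sup>2 + 2 * (cmod (F x))\<^sup>2)"
    by auto
  show "(\<lambda>x. (cmod ((F \<circ> T) x - F x))\<^sup>2) \<in> borel_measurable M"
    by measurable
  have "(cmod (a - b))\<^sup>2 \<le> 2 * (cmod a)\<^sup>2 + 2 * (cmod b)\<^sup>2" for a b
  proof -
    have "(cmod (a - b))\<^sup>2 \<le> (cmod a + cmod b)\<^sup>2"
      by (intro power_mono norm_triangle_ineq4) auto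
    also have "\<dots> \<le> 2 * (cmod a)\<^sup>2 + 2 * (cmod b)\<^sup>2"
      using sum_squares_bound[of "cmod a" "cmod b"] by (simp add: power2_sum)
    finally show ?thesis .
  qed
  then show "AE x in M. norm ((cmod ((F \<circ> T) x - F x))\<^sup>2) \<le>
      norm (2 * (cmod (F (T x)))\<^sup>2 + 2 * (cmod (F x))\<^sup>2)"
    by simp
qed

lemma AE_eq_if_norm2_comp_diff_eq_0:
  assumes "F \<in> L2 M" and "invertible_measure_preserving M T"
    and "norm2 M (\<lambda>x. (F \<circ> T) x - F x) = 0"
  shows "AE x in M. F (T x) = F x"
proof -
  have "(\<integral>x. (cmod ((F \<circ> T) x - F x))\<^sup>2 \<partial>M) = 0"
    using assms(3) by (simp add: norm2_def)
  then have "AE x in M. (cmod ((F \<circ> T) x - F x))\<^sup>2 = 0"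
    by (subst (asm) integral_nonneg_eq_0_iff_AE[OF L2_comp_diff_integrable[OF assms(1,2)]]) auto
  then show ?thesis
    by simp
qed

lemma (in prob_space) indicator_in_L2:
  assumes "A \<in> events"
  shows "indicator A \<in> L2 M"
proof -
  have "(\<lambda>x. (cmod (indicator A x))\<^sup>2) = (indicator A :: 'a \<Rightarrow> real)"
    by (auto simp: indicator_def)
  then show ?thesis
    using assms by (simp add: L2_def less_top[symmetric])
qed

text \<open>Two indicator values differ by at most 1 and the total mass is 1. This serves the primes
  that move \<open>F\<close>.\<close>

lemma (in prob_space) norm2_indicator_comp_diff_le_1:
  fixes A :: "'a set"
  shows "norm2 M (\<lambda>x. ((indicator A :: 'a \<Rightarrow> complex) \<circ> T) x - indicator A x) \<le> 1"
proof -
  have "(\<integral>x. (cmod (((indicator A :: 'a \<Rightarrow> complex) \<circ> T) x - indicator A x))\<^sup>2 \<partial>M) \<le> (\<integral>x. 1 \<partial>M)"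
    by (rule integral_mono') (auto simp: indicator_def)
  then show ?thesis
    by (simp add: norm2_def prob_space)
qed

lemma H1_summable_onI:
  assumes "F \<in> L2 M"
    and "(\<lambda>p. (norm2 M (\<lambda>x. (F \<circ> S p) x - F x))\<^sup>2 / real p) summable_on {p. prime p}"
  shows "F \<in> H1 M S"
  unfolding H1_def using assms(1) summable_on_cmult_right[OF assms(2), of "1 / 2"] by blast

lemma indicator_vimage_in_H1:
  fixes M :: "'a::metric_space measure"
  assumes "multiplicative_system M S" and fg: "finitely_generated M S"
    and F: "F \<in> H1 M S" and B: "B \<in> sets borel"
  shows "indicator (F -` B \<inter> space M) \<in> H1 M S"
proof -
  interpret multiplicative_system M S by fact
  let ?A = "F -` B \<inter> space M"
  let ?d = "\<lambda>G p. norm2 M (\<lambda>x. (G \<circ> S p) x - (G x :: complex))"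
  have FL2: "F \<in> L2 M" and sum: "(\<lambda>p. 1 / 2 * ((?d F p)\<^sup>2 / real p)) summable_on {p. prime p}"
    using F by (auto simp: H1_def)
  have "F \<in> borel_measurable M"
    using FL2 by (auto simp: L2_def)
  then have A: "?A \<in> events"
    using B by (rule measurable_sets)
  have nonneg: "?d G p \<ge> 0" for G p
    by (simp add: norm2_def)
  let ?V = "insert 1 (?d F ` {p. prime p} - {0})"
  define m where "m = Min ?V"
  have fin: "finite ?V"
    using finite_norm2_diffs[OF fg, of F] by auto
  have "m > 0"
    unfolding m_def using fin nonneg by (subst Min_gr_iff) (auto simp: less_le)
  have bound: "(?d (indicator ?A) p)\<^sup>2 \<le> 1 / m\<^sup>2 * (?d F p)\<^sup>2" if "prime p" for p
  proof (cases "?d F p = 0")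
    case True
    have T: "invertible_measure_preserving M (S p)"
      using inv_mp prime_ge_1_nat[OF that] by simp
    \<comment> \<open>Where \<open>F (S p x) = F x\<close>, the points \<open>x\<close> and
      \<open>S p x\<close> are both in \<open>?A\<close> or both outside; \<open>S p x\<close> stays
      in \<open>space M\<close>.\<close>
    have "AE x in M. (cmod ((indicator ?A \<circ> S p) x - indicator ?A x))\<^sup>2 = 0"
      using AE_eq_if_norm2_comp_diff_eq_0[OF FL2 T True] AE_space
    proof eventually_elim
      case (elim x)
      then show ?case
        using measurable_space[OF invertible_measure_preservingD(1)[OF T], of x]
        by (auto simp: indicator_def)
    qed
    then have "?d (indicator ?A) p = 0"
      unfolding norm2_def by (subst integral_eq_zero_AE) auto
    with True show ?thesis
      by simp
  next
    case False
    then have "m \<le> ?d F p"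
      unfolding m_def using fin that by (intro Min_le) auto
    then have "m\<^sup>2 \<le> (?d F p)\<^sup>2"
      using \<open>m > 0\<close> by (intro power_mono) auto
    moreover have "(?d (indicator ?A) p)\<^sup>2 \<le> 1"
      using nonneg norm2_indicator_comp_diff_le_1 by (intro power_le_one) auto
    ultimately show ?thesis
      \<comment> \<open>Multiplying the bound 1 by the square of \<open>m\<close> gives at most that
        square, hence at most the squared norm for \<open>F\<close>.\<close>
      using \<open>m > 0\<close> by (simp add: field_simps) (smt (verit) mult_left_le zero_le_power2)
  qed
  have "(\<lambda>p. (?d (indicator ?A) p)\<^sup>2 / real p) summable_on {p. prime p}"
  proof (rule summable_on_comparison_test)
    \<comment> \<open>The 2 cancels the factor 1/2 in the definition of \<open>H1\<close>.\<close>
    show "(\<lambda>p. 2 / m\<^sup>2 * (1 / 2 * ((?d F p)\<^sup>2 / real p))) summable_on {p. prime p}"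
      by (rule summable_on_cmult_right[OF sum])
    show "(?d (indicator ?A) p)\<^sup>2 / real p \<le> 2 / m\<^sup>2 * (1 / 2 * ((?d F p)\<^sup>2 / real p))"
      if "p \<in> {p. prime p}" for p
      using divide_right_mono[OF bound, of p "real p"] that by simp
  qed simp
  then show ?thesis
    by (rule H1_summable_onI[OF indicator_in_L2[OF A]])
qed

text \<open>A variable that lies almost surely strictly on one side of a number has its mean
  strictly on that side too. So neither event has probability 1, and both are null.\<close>

lemma (in prob_space) AE_eq_expectation_if_trivial_events:
  fixes X :: "'a \<Rightarrow> real"
  assumes X: "integrable M X"
    and less: "prob {x \<in> space M. X x < expectation X} \<in> {0, 1}"
    and greater: "prob {x \<in> space M. X x > expectation X} \<in> {0, 1}"
  shows "AE x in M. X x = expectation X"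
proof -
  have [measurable]: "X \<in> borel_measurable M"
    using X by simp
  have "\<not> (AE x in M. X x < expectation X)"
    using expectation_less[OF X, of "expectation X"] by auto
  then have "prob {x \<in> space M. X x < expectation X} = 0"
    using less by (auto simp: prob_Collect_eq_1)
  then have "AE x in M. \<not> X x < expectation X"
    by (subst (asm) prob_Collect_eq_0) auto
  moreover have "\<not> (AE x in M. X x > expectation X)"
    using expectation_greater[OF X, of "expectation X"] by auto
  then have "prob {x \<in> space M. X x > expectation X} = 0"
    using greater by (auto simp: prob_Collect_eq_1)
  then have "AE x in M. \<not> X x > expectation X"
    by (subst (asm) prob_Collect_eq_0) auto
  ultimately show ?thesis
    by eventually_elim auto
qed

lemma (in prob_space) L2_integrable:
  assumes "F \<in> L2 M"
  shows "integrable M F"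
proof -
  have [measurable]: "F \<in> borel_measurable M" and F: "integrable M (\<lambda>x. (cmod (F x))\<^sup>2)"
    using assms by (auto simp: L2_def)
  have "integrable M (\<lambda>x. cmod (F x))"
    by (rule square_integrable_imp_integrable[OF _ F]) measurable
  then show ?thesis
    by (simp add: integrable_norm_iff)
qed

lemma pretentiously_ergodic_imp_AE_const:
  fixes M :: "'a::metric_space measure"
  assumes ms: "multiplicative_system M S" and fg: "finitely_generated M S"
    and "pretentiously_ergodic M S" and F: "F \<in> H1 M S"
  shows "\<exists>c. AE x in M. F x = c"
proof -
  interpret multiplicative_system M S by fact
  have L2: "F \<in> L2 M"
    using F by (simp add: H1_def)
  then have [measurable]: "F \<in> borel_measurable M"
    by (simp add: L2_def)
  have trivial: "prob {x \<in> space M. F x \<in> B} \<in> {0, 1}" if B: "B \<in> sets borel" for B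
  proof -
    have "F -` B \<inter> space M \<in> events"
      using B by measurable
    then have "prob (F -` B \<inter> space M) \<in> {0, 1}"
      using assms(3) indicator_vimage_in_H1[OF ms fg F B] by (auto simp: pretentiously_ergodic_def)
    moreover have "F -` B \<inter> space M = {x \<in> space M. F x \<in> B}"
      by auto
    ultimately show ?thesis
      by simp
  qed
  \<comment> \<open>Comparison with the mean needs an ordered range, so \<open>F\<close> is composed
    with a real functional \<open>g\<close>, later \<open>Re\<close> and \<open>Im\<close>. The
    events are then preimages under \<open>F\<close> of open half-planes, or of the empty set if
    \<open>g\<close> is 0.\<close>
  have const: "AE x in M. g (F x) = (\<integral>x. g (F x) \<partial>M)"
    if "bounded_linear g" for g :: "complex \<Rightarrow> real"
  proof (rule AE_eq_expectation_if_trivial_events)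
    have g: "g \<in> borel_measurable borel"
      using that by (intro borel_measurable_continuous_onI linear_continuous_on)
    show "integrable M (\<lambda>x. g (F x))"
      using integrable_bounded_linear[OF that L2_integrable[OF L2]] .
    show "prob {x \<in> space M. g (F x) < (\<integral>x. g (F x) \<partial>M)} \<in> {0, 1}"
      using trivial[of "{z. g z < (\<integral>x. g (F x) \<partial>M)}"] g by simp
    show "prob {x \<in> space M. g (F x) > (\<integral>x. g (F x) \<partial>M)} \<in> {0, 1}"
      using trivial[of "{z. g z > (\<integral>x. g (F x) \<partial>M)}"] g by simp
  qed
  have "AE x in M. F x = Complex (\<integral>x. Re (F x) \<partial>M) (\<integral>x. Im (F x) \<partial>M)"
    using const[OF bounded_linear_Re] const[OF bounded_linear_Im]
    by eventually_elim (simp add: complex_eq_iff)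
  then show ?thesis ..
qed

text \<open>This gives the converse direction, applied to indicators in \<open>H1\<close>. If
  \<open>c\<close> is not 1, a point of \<open>A\<close> violates the equation, so \<open>A\<close>
  is null; the value of \<open>c\<close> need not be known further.\<close>

lemma (in prob_space) prob_trivial_if_indicator_AE_const:
  assumes "A \<in> events" and "AE x in M. indicator A x = (c :: 'b::zero_neq_one)"
  shows "prob A \<in> {0, 1}"
proof (cases "c = 1")
  case True
  with assms(2) have "AE x in M. x \<in> A"
    by (simp add: indicator_eq_1_iff)
  then show ?thesis
    by (simp add: prob_eq_1 assms(1))
next
  case False
  with assms(2) have "AE x in M. x \<notin> A"
    by (auto simp: indicator_def elim: eventually_mono split: if_splits)
  then show ?thesis
    by (simp add: prob_eq_0 assms(1))
qed

theorem corollary1p11: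
  fixes M :: "'a::metric_space measure" and S :: "nat \<Rightarrow> 'a \<Rightarrow> 'a"
  assumes "multiplicative_system M S" and "finitely_generated M S"
  shows "pretentiously_ergodic M S \<longleftrightarrow> (\<forall>F \<in> H1 M S. \<exists>c. AE x in M. F x = c)"
proof
  assume "pretentiously_ergodic M S"
  then show "\<forall>F \<in> H1 M S. \<exists>c. AE x in M. F x = c"
    using pretentiously_ergodic_imp_AE_const[OF assms] by blast
next
  interpret multiplicative_system M S by fact
  assume "\<forall>F \<in> H1 M S. \<exists>c. AE x in M. F x = c"
  then show "pretentiously_ergodic M S"
    unfolding pretentiously_ergodic_def using prob_trivial_if_indicator_AE_const by blast
qed

end
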